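(* Let $\Pi=\mathbb{R}/\mathbb{Z}$ be the circle. Let $a\in C^2(\Pi)$ with $a>0$ and $b\in C^1(\Pi)$. Assume that $b$ changes sign on $\Pi$ (it takes both positive and negative values), that $b$ vanishes at only finitely many points $x_1,\dots,x_n$, and that each zero $x_i$ of $b$ is either of finite order $m_i\ge1$ or flat. For $\epsilon>0$ and a probability measure $\mu$ on $\Pi$ let $$I_\epsilon(\mu):=\sup_{u\in C^2(\Pi),\,u>0}\;-\int_\Pi\frac{\epsilon\,a\,u''+b\,u'}{u}\,d\mu .$$ Then for every probability measure $\mu$ on $\Pi$, $$\lim_{\epsilon\to0}I_\epsilon(\mu)=+\infty .$$
   Context: A zero $x_i$ of $b$ is of finite order $m_i\ge1$ if $b$ is $C^{m_i}$ in a neighborhood of $x_i$, $b(x_i)=\dots=b^{(m_i-1)}(x_i)=0$ and $b^{(m_i)}(x_i)\ne0$. It is flat if $b$ is $C^\infty$ in a neighborhood of $x_i$ and $b^{(k)}(x_i)=0$ for all $k\in\mathbb{N}$. *)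

theory Defs
  imports "HOL-Probability.Probability"
begin

quotient_type circle = real / "\<lambda>x y :: real. x - y \<in> \<int>"
  morphisms circle_rep circle_of
proof (rule equivpI)
  show "reflp (\<lambda>x y :: real. x - y \<in> \<int>)"
    by (simp add: reflp_def)
  show "symp (\<lambda>x y :: real. x - y \<in> \<int>)"
  proof (rule sympI)
    fix x y :: real
    assume "x - y \<in> \<int>"
    then have "- (x - y) \<in> \<int>" by (rule Ints_minus)
    then show "y - x \<in> \<int>" by simp
  qed
  show "transp (\<lambda>x y :: real. x - y \<in> \<int>)"
  proof (rule transpI)
    fix x y z :: real
    assume "x - y \<in> \<int>" "y - z \<in> \<int>"
    then have "(x - y) + (y - z) \<in> \<int>" by (rule Ints_add)
    then show "x - z \<in> \<int>" by simp
  qed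
qed

lemma circle_of_eq_iff: "circle_of x = circle_of y \<longleftrightarrow> x - y \<in> \<int>"
  by (rule circle.abs_eq_iff)

lemma circle_of_surj: "\<exists>x. p = circle_of x"
  by (rule exI[of _ "circle_rep p"]) (simp add: Quotient3_abs_rep[OF Quotient3_circle])

text \<open>The circle carries the quotient topology; \<^term>\<open>borel\<close> on it is the induced
  Borel sigma-algebra.\<close>

instantiation circle :: topological_space
begin

definition open_circle :: "circle set \<Rightarrow> bool" where
  "open_circle U \<longleftrightarrow> open (circle_of -` U)"

instance
proof
  show "open (UNIV :: circle set)"
    by (simp add: open_circle_def)
  show "open (S \<inter> T)" if "open S" "open T" for S T :: "circle set"
    using that by (simp add: open_circle_def vimage_Int open_Int)
  show "open (\<Union>K)" if "\<forall>S\<in>K. open S" for K :: "circle set set"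
    using that by (simp add: open_circle_def vimage_Union open_UN)
qed

end

lemma shift_has_field_derivative_iff:
  fixes f :: "circle \<Rightarrow> real"
  assumes "x - y \<in> \<int>"
  shows "((\<lambda>t. f (circle_of t)) has_field_derivative D) (at x) \<longleftrightarrow>
         ((\<lambda>t. f (circle_of t)) has_field_derivative D) (at y)"
proof -
  have "circle_of (t + (x - y)) = circle_of t" for t
    using assms by (simp add: circle_of_eq_iff)
  moreover have "((\<lambda>t. f (circle_of t)) has_field_derivative D) (at (y + (x - y))) \<longleftrightarrow>
      ((\<lambda>t. f (circle_of (t + (x - y)))) has_field_derivative D) (at y)"
    by (rule DERIV_shift)
  ultimately show ?thesis by simp
qed

text \<open>Differentiability and the derivative on the circle are those of the 1-periodic lift
  of the function to the real line.\<close>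

lift_definition circle_differentiable :: "(circle \<Rightarrow> real) \<Rightarrow> circle \<Rightarrow> bool" is
  "\<lambda>f x. (\<lambda>t. f (circle_of t)) differentiable (at x)"
  by (simp add: real_differentiable_def shift_has_field_derivative_iff)

lift_definition circle_deriv :: "(circle \<Rightarrow> real) \<Rightarrow> circle \<Rightarrow> real" is
  "\<lambda>f x. deriv (\<lambda>t. f (circle_of t)) x"
  by (simp add: deriv_def shift_has_field_derivative_iff)

text \<open>Intended for open \<^term>\<open>U\<close>.\<close>

definition Ck_on :: "nat \<Rightarrow> circle set \<Rightarrow> (circle \<Rightarrow> real) \<Rightarrow> bool" where
  "Ck_on k U f \<longleftrightarrow>
     (\<forall>j<k. \<forall>p\<in>U. circle_differentiable ((circle_deriv ^^ j) f) p) \<and>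
     continuous_on U ((circle_deriv ^^ k) f)"

definition zero_of_order :: "(circle \<Rightarrow> real) \<Rightarrow> circle \<Rightarrow> nat \<Rightarrow> bool" where
  "zero_of_order b p m \<longleftrightarrow>
     1 \<le> m \<and>
     (\<exists>U. open U \<and> p \<in> U \<and> Ck_on m U b) \<and>
     (\<forall>k<m. (circle_deriv ^^ k) b p = 0) \<and>
     (circle_deriv ^^ m) b p \<noteq> 0"

definition flat_zero :: "(circle \<Rightarrow> real) \<Rightarrow> circle \<Rightarrow> bool" where
  "flat_zero b p \<longleftrightarrow>
     (\<exists>U. open U \<and> p \<in> U \<and> (\<forall>k. Ck_on k U b)) \<and>
     (\<forall>k. (circle_deriv ^^ k) b p = 0)"

text \<open>The supremum is taken in the extended reals, so that it may be infinite. For continuous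
  \<^term>\<open>a\<close> and \<^term>\<open>b\<close> and a Borel probability measure, every integrand is continuous on the
  compact circle, hence integrable.\<close>

definition rate_functional ::
  "(circle \<Rightarrow> real) \<Rightarrow> (circle \<Rightarrow> real) \<Rightarrow> real \<Rightarrow> circle measure \<Rightarrow> ereal" where
  "rate_functional a b \<epsilon> \<mu> =
     (SUP u \<in> {u. Ck_on 2 UNIV u \<and> (\<forall>p. u p > 0)}.
        ereal (- (\<integral>p. (\<epsilon> * a p * (circle_deriv ^^ 2) u p + b p * circle_deriv u p) / u p \<partial>\<mu>)))"

end

theory Submission
  imports Defs
begin

text \<open>Test the supremum with \<open>u = exp (c \<phi>)\<close>: it is at least
  \<open>- \<epsilon> c A - \<epsilon> c\<^sup>2 Q - c K\<close>, where \<open>A\<close>, \<open>Q\<close>, \<open>K\<close> are the \<open>\<mu>\<close>-integrals of \<open>a \<phi>''\<close>,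
  \<open>a \<phi>'\<^sup>2\<close> and \<open>b \<phi>'\<close>. If \<open>b\<close> is not \<open>\<mu>\<close>-almost everywhere zero, take \<open>\<phi>' = b \<bar>b\<bar> + \<beta> b\<^sup>2\<close>
  with \<open>\<beta>\<close> chosen so that \<open>\<phi>'\<close> has mean zero. As \<open>b\<close> changes sign, \<open>\<bar>\<beta>\<bar> < 1\<close>, hence
  \<open>b \<phi>' \<ge> (1 - \<bar>\<beta>\<bar>) \<bar>b\<bar>\<^sup>3\<close> and \<open>K > 0\<close>; then \<open>c = - s / \<epsilon>\<close> with small \<open>s > 0\<close> works.
  Otherwise \<open>\<mu>\<close> lives on the finitely many zeros of \<open>b\<close>; take \<open>\<phi>\<close> with nondegenerate
  minima there, so that \<open>Q = K = 0 < A\<close>, and \<open>c = - 1 / \<epsilon>\<^sup>2\<close>.\<close>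

section \<open>Functions on the circle and their periodic lifts\<close>

text \<open>The quotient topology tests openness on the real line, so preimages under a function and
  under its lift agree. This carries every continuity question to the lift.\<close>

lemma continuous_on_circle_iff:
  fixes f :: "circle \<Rightarrow> 'a::topological_space"
  shows "continuous_on UNIV f \<longleftrightarrow> continuous_on UNIV (\<lambda>t. f (circle_of t))"
proof -
  have "circle_of -` f -` B = (\<lambda>t. f (circle_of t)) -` B" for B
    by auto
  then show ?thesis
    by (simp add: continuous_on_open_vimage open_circle_def)
qed

lemma circle_of_add_1 [simp]: "circle_of (t + 1) = circle_of t"
  by (simp add: circle_of_eq_iff)

text \<open>The witness is \<open>\<lambda>p. F (circle_rep p)\<close>: the chosen representative of
  \<open>circle_of t\<close> differs from \<open>t\<close> by an integer, which \<open>F\<close>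
  does not see.\<close>

lemma periodic_lift:
  fixes F :: "real \<Rightarrow> 'a"
  assumes "\<And>t. F (t + 1) = F t"
  obtains f where "\<And>t. f (circle_of t) = F t"
proof
  interpret periodic_fun_simple' F
    by unfold_locales (rule assms)
  fix t
  have "circle_of (circle_rep (circle_of t)) = circle_of t"
    by (simp add: Quotient3_abs_rep[OF Quotient3_circle])
  then obtain n where "circle_rep (circle_of t) = t + of_int n"
    by (metis Ints_cases add.commute circle_of_eq_iff diff_add_cancel)
  then show "F (circle_rep (circle_of t)) = F t"
    by (simp add: plus_of_int)
qed

lemma circle_deriv_lift:
  assumes "((\<lambda>t. f (circle_of t)) has_field_derivative D) (at t)"
  shows "circle_deriv f (circle_of t) = D"
  using assms by (simp add: circle_deriv.abs_eq DERIV_imp_deriv)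

lemma circle_differentiable_lift_iff:
  "circle_differentiable f (circle_of t) \<longleftrightarrow>
   ((\<lambda>t. f (circle_of t)) has_field_derivative circle_deriv f (circle_of t)) (at t)"
proof
  assume "circle_differentiable f (circle_of t)"
  then show "((\<lambda>t. f (circle_of t)) has_field_derivative circle_deriv f (circle_of t)) (at t)"
    by (simp add: circle_deriv.abs_eq circle_differentiable.abs_eq
        DERIV_deriv_iff_real_differentiable)
next
  assume "((\<lambda>t. f (circle_of t)) has_field_derivative circle_deriv f (circle_of t)) (at t)"
  then show "circle_differentiable f (circle_of t)"
    unfolding circle_differentiable.abs_eq real_differentiable_def by blast
qed

lemma C1_lift:
  assumes "Ck_on 1 UNIV f"
  shows "((\<lambda>t. f (circle_of t)) has_field_derivative circle_deriv f (circle_of t)) (at t)"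
    and "continuous_on UNIV (circle_deriv f)"
  using assms unfolding circle_differentiable_lift_iff[symmetric] by (simp_all add: Ck_on_def)

lemma C2_lift:
  assumes "Ck_on 2 UNIV f"
  shows "((\<lambda>t. f (circle_of t)) has_field_derivative circle_deriv f (circle_of t)) (at t)"
    and "((\<lambda>t. circle_deriv f (circle_of t)) has_field_derivative
          (circle_deriv ^^ 2) f (circle_of t)) (at t)"
    and "continuous_on UNIV ((circle_deriv ^^ 2) f)"
proof -
  have *: "circle_differentiable ((circle_deriv ^^ j) f) p" if "j < 2" for j p
    using assms that by (simp add: Ck_on_def)
  show "((\<lambda>t. f (circle_of t)) has_field_derivative circle_deriv f (circle_of t)) (at t)"
    using *[of 0] unfolding circle_differentiable_lift_iff[symmetric] by simp
  show "((\<lambda>t. circle_deriv f (circle_of t)) has_field_derivative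
          (circle_deriv ^^ 2) f (circle_of t)) (at t)"
    using *[of 1, of "circle_of t"] by (simp add: circle_differentiable_lift_iff numeral_2_eq_2)
  show "continuous_on UNIV ((circle_deriv ^^ 2) f)"
    using assms by (simp add: Ck_on_def)
qed

lemma DERIV_lift_imp_continuous_on:
  assumes "\<And>t. ((\<lambda>t. f (circle_of t)) has_field_derivative D t) (at t)"
  shows "continuous_on UNIV f"
  unfolding continuous_on_circle_iff
  using assms by (meson DERIV_isCont continuous_at_imp_continuous_on)

text \<open>Test functions are built as explicit periodic functions on the line; this brings their
  regularity and both derivatives back to the circle.\<close>

lemma C2_circle:
  assumes u: "\<And>t. u (circle_of t) = U t"
    and U: "\<And>t. (U has_field_derivative U' t) (at t)"
    and U': "\<And>t. (U' has_field_derivative U'' t) (at t)"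
    and cont: "continuous_on UNIV U''"
  shows "Ck_on 2 UNIV u"
    and "circle_deriv u (circle_of t) = U' t"
    and "(circle_deriv ^^ 2) u (circle_of t) = U'' t"
proof -
  have d1: "circle_deriv u (circle_of t) = U' t" for t
    by (rule circle_deriv_lift) (simp add: u U)
  have d2: "circle_deriv (circle_deriv u) (circle_of t) = U'' t" for t
    by (rule circle_deriv_lift) (simp add: d1 U')
  show "circle_deriv u (circle_of t) = U' t"
    by (rule d1)
  show "(circle_deriv ^^ 2) u (circle_of t) = U'' t"
    by (simp add: numeral_2_eq_2 d2)
  have "circle_differentiable u p" "circle_differentiable (circle_deriv u) p" for p
    using circle_of_surj[of p]
    by (auto simp: circle_differentiable_lift_iff u d1 d2 U U')
  moreover have "continuous_on UNIV (circle_deriv (circle_deriv u))"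
    by (simp add: continuous_on_circle_iff d2 cont)
  ultimately show "Ck_on 2 UNIV u"
    by (auto simp: Ck_on_def numeral_2_eq_2 less_Suc_eq)
qed

text \<open>Compactness is used on the interval \<open>{0..1}\<close>, which covers the circle by
  way of fractional parts.\<close>

lemma bounded_circle:
  fixes f :: "circle \<Rightarrow> real"
  assumes "continuous_on UNIV f"
  obtains C where "\<And>p. \<bar>f p\<bar> \<le> C"
proof -
  have "continuous_on {0..1} (\<lambda>t. f (circle_of t))"
    using assms continuous_on_circle_iff continuous_on_subset by blast
  then have "bounded ((\<lambda>t. f (circle_of t)) ` {0..1})"
    by (intro compact_imp_bounded compact_continuous_image) auto
  then obtain C where C: "\<And>t. t \<in> {0..1} \<Longrightarrow> \<bar>f (circle_of t)\<bar> \<le> C"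
    unfolding bounded_iff by fastforce
  have "\<bar>f p\<bar> \<le> C" for p
  proof -
    obtain x where "p = circle_of x"
      using circle_of_surj by blast
    then have "p = circle_of (frac x)"
      by (simp add: circle_of_eq_iff frac_def)
    then show ?thesis
      using C[of "frac x"] by (simp add: frac_ge_0 frac_lt_1 less_imp_le)
  qed
  then show thesis by (rule that)
qed

lemma integrable_circle:
  fixes f :: "circle \<Rightarrow> real"
  assumes "prob_space \<mu>" "sets \<mu> = sets borel" "continuous_on UNIV f"
  shows "integrable \<mu> f"
proof -
  interpret prob_space \<mu> by fact
  obtain C where "\<And>p. \<bar>f p\<bar> \<le> C"
    using bounded_circle assms(3) by blast
  moreover have "f \<in> borel_measurable \<mu>"
    using borel_measurable_continuous_onI[OF assms(3)] measurable_cong_sets[OF assms(2) refl]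
    by blast
  ultimately show ?thesis
    by (intro integrable_const_bound[where B = C]) auto
qed

section \<open>Exponential test functions\<close>

text \<open>For \<open>u = exp (c * \<phi>)\<close> the quotients are
  \<open>u' / u = c * \<phi>'\<close> and
  \<open>u'' / u = c * \<phi>'' + c\<^sup>2 * \<phi>'\<^sup>2\<close>, so the integrand is
  polynomial in \<open>c\<close>. The sign of \<open>c\<close> stays free.\<close>

lemma rate_functional_ge:
  fixes a b \<phi> :: "circle \<Rightarrow> real"
  assumes \<mu>: "prob_space \<mu>" "sets \<mu> = sets borel"
    and a: "continuous_on UNIV a" and b: "continuous_on UNIV b"
    and \<phi>: "Ck_on 2 UNIV \<phi>"
  shows "ereal (- \<epsilon> * c * (\<integral>p. a p * (circle_deriv ^^ 2) \<phi> p \<partial>\<mu>)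
           - \<epsilon> * c\<^sup>2 * (\<integral>p. a p * (circle_deriv \<phi> p)\<^sup>2 \<partial>\<mu>)
           - c * (\<integral>p. b p * circle_deriv \<phi> p \<partial>\<mu>)) \<le> rate_functional a b \<epsilon> \<mu>"
proof -
  let ?d1 = "circle_deriv \<phi>" and ?d2 = "(circle_deriv ^^ 2) \<phi>"
  define u where "u p = exp (c * \<phi> p)" for p
  note \<phi>_lift = C2_lift[OF \<phi>]
  \<comment> \<open>\<open>\<phi>\<close> and its first derivative are continuous because their
    lifts are differentiable; for the second derivative continuity is part of
    \<open>Ck_on\<close>.\<close>
  have cont: "continuous_on UNIV \<phi>" "continuous_on UNIV ?d1" "continuous_on UNIV ?d2"
    by (rule DERIV_lift_imp_continuous_on, rule \<phi>_lift | rule \<phi>_lift)+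
  have "continuous_on UNIV (\<lambda>p. (c * ?d2 p + c\<^sup>2 * (?d1 p)\<^sup>2) * exp (c * \<phi> p))"
    by (intro continuous_intros cont)
  then have cont_lift: "continuous_on UNIV (\<lambda>t. (c * ?d2 (circle_of t) + c\<^sup>2 * (?d1 (circle_of t))\<^sup>2)
      * exp (c * \<phi> (circle_of t)))"
    by (subst (asm) continuous_on_circle_iff)
  have U: "((\<lambda>t. exp (c * \<phi> (circle_of t))) has_field_derivative
      c * ?d1 (circle_of t) * exp (c * \<phi> (circle_of t))) (at t)" for t
    by (auto intro!: derivative_eq_intros \<phi>_lift)
  have U': "((\<lambda>t. c * ?d1 (circle_of t) * exp (c * \<phi> (circle_of t))) has_field_derivative
      (c * ?d2 (circle_of t) + c\<^sup>2 * (?d1 (circle_of t))\<^sup>2) * exp (c * \<phi> (circle_of t))) (at t)" for t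
    by (auto intro!: derivative_eq_intros \<phi>_lift simp: algebra_simps power2_eq_square)
  note u_C2 = C2_circle[of u, OF u_def U U' cont_lift]
  have du: "circle_deriv u p = c * ?d1 p * u p"
    "(circle_deriv ^^ 2) u p = (c * ?d2 p + c\<^sup>2 * (?d1 p)\<^sup>2) * u p" for p
    using circle_of_surj[of p] u_C2 by (auto simp: u_def)
  have u_pos: "u p > 0" for p
    by (simp add: u_def)
  have "(\<epsilon> * a p * (circle_deriv ^^ 2) u p + b p * circle_deriv u p) / u p
      = \<epsilon> * c * (a p * ?d2 p) + \<epsilon> * c\<^sup>2 * (a p * (?d1 p)\<^sup>2) + c * (b p * ?d1 p)" for p
    using u_pos[of p] by (simp add: du field_simps)
  moreover have "integrable \<mu> (\<lambda>p. a p * ?d2 p)" "integrable \<mu> (\<lambda>p. a p * (?d1 p)\<^sup>2)"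
    "integrable \<mu> (\<lambda>p. b p * ?d1 p)"
    by (intro integrable_circle[OF \<mu>] continuous_intros a b cont)+
  ultimately have "(\<integral>p. (\<epsilon> * a p * (circle_deriv ^^ 2) u p + b p * circle_deriv u p) / u p \<partial>\<mu>)
     = \<epsilon> * c * (\<integral>p. a p * ?d2 p \<partial>\<mu>) + \<epsilon> * c\<^sup>2 * (\<integral>p. a p * (?d1 p)\<^sup>2 \<partial>\<mu>)
       + c * (\<integral>p. b p * ?d1 p \<partial>\<mu>)"
    by simp
  moreover have "u \<in> {u. Ck_on 2 UNIV u \<and> (\<forall>p. u p > 0)}"
    using u_C2(1) u_pos by blast
  ultimately show ?thesis
    unfolding rate_functional_def by (intro SUP_upper2[of u]) (simp_all add: algebra_simps)
qed

text \<open>Both cases of the theorem end in a lower bound of this shape.\<close>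

lemma tendsto_PInfty_at_right_0:
  fixes f :: "real \<Rightarrow> ereal"
  assumes "k > 0" "\<And>\<epsilon>. \<epsilon> > 0 \<Longrightarrow> ereal (l + k / \<epsilon>) \<le> f \<epsilon>"
  shows "(f \<longlongrightarrow> \<infinity>) (at_right 0)"
  unfolding tendsto_PInfty
proof
  fix r
  have "filterlim (\<lambda>\<epsilon>. k * inverse \<epsilon>) at_top (at_right (0::real))"
    by (intro filterlim_tendsto_pos_mult_at_top[OF tendsto_const assms(1)]
        filterlim_inverse_at_top_right)
  then have "\<forall>\<^sub>F \<epsilon> in at_right 0. r - l < k * inverse \<epsilon>"
    by (simp add: filterlim_at_top_dense)
  then show "\<forall>\<^sub>F \<epsilon> in at_right 0. ereal r < f \<epsilon>"
    using eventually_at_right_less[of 0]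
  proof eventually_elim
    case (elim \<epsilon>)
    then have "ereal r < ereal (l + k / \<epsilon>)"
      by (simp add: divide_inverse)
    also have "\<dots> \<le> f \<epsilon>"
      using assms(2) elim by simp
    finally show ?case .
  qed
qed

section \<open>Measures charging the complement of the zeros\<close>

text \<open>Unlike the absolute value, this function is continuously differentiable at 0. Hence
  \<open>b * \<bar>b\<bar>\<close> is C1 for C1 \<open>b\<close> and may serve in the derivative of
  a C2 test function.\<close>

lemma DERIV_times_abs: "((\<lambda>x::real. x * \<bar>x\<bar>) has_field_derivative 2 * \<bar>x\<bar>) (at x)"
proof (cases "x = 0")
  case True
  have "((\<lambda>h. (h * \<bar>h\<bar>) / h) \<longlongrightarrow> 0) (at (0::real))"
  proof (rule Lim_transform_eventually)
    show "((\<lambda>h. \<bar>h\<bar>) \<longlongrightarrow> 0) (at (0::real))"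
      by (auto intro!: tendsto_eq_intros)
    show "\<forall>\<^sub>F h in at (0::real). \<bar>h\<bar> = h * \<bar>h\<bar> / h"
      by (simp add: eventually_at_filter)
  qed
  then show ?thesis
    by (simp add: DERIV_def True)
next
  case False
  \<comment> \<open>On the open half-line containing \<open>x\<close> the function is
    \<open>sgn x * y\<^sup>2\<close>.\<close>
  have "((\<lambda>y. sgn x * y\<^sup>2) has_field_derivative 2 * \<bar>x\<bar>) (at x)"
    by (auto intro!: derivative_eq_intros simp: abs_sgn)
  moreover have "open (if x > 0 then {0<..} else {..<0::real})"
    by simp
  ultimately show ?thesis
    by (rule has_field_derivative_transform_within_open)
      (use False in \<open>auto simp: power2_eq_square abs_if split: if_splits\<close>)
qed

lemma antiderivative_exists:
  fixes f :: "real \<Rightarrow> real"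
  assumes "continuous_on UNIV f"
  obtains F where "\<And>x. (F has_field_derivative f x) (at x)"
proof -
  have "\<exists>F. \<forall>x::real. - \<infinity> < ereal x \<longrightarrow> ereal x < \<infinity> \<longrightarrow> (F has_vector_derivative f x) (at x)"
    using assms by (intro einterval_antiderivative) (auto simp: continuous_on_eq_continuous_at)
  then show thesis
    using that by (auto simp: has_real_derivative_iff_has_vector_derivative)
qed

text \<open>The difference has derivative \<open>f (x + 1) - f x = 0\<close>. The constant
  \<open>F 1 - F 0\<close> is the mean of \<open>f\<close> over a period, and \<open>F\<close> is
  periodic exactly when it vanishes.\<close>

lemma antiderivative_periodic_shift:
  fixes F :: "real \<Rightarrow> real"
  assumes F: "\<And>x. (F has_field_derivative f x) (at x)" and f: "\<And>x. f (x + 1) = f x"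
  shows "F (x + 1) = F x + (F 1 - F 0)"
proof -
  have "((\<lambda>x. F (x + 1) - F x) has_field_derivative 0) (at x)" for x
    using DERIV_diff[OF F[of "x + 1", unfolded DERIV_shift] F[of x]] f by simp
  then show ?thesis
    using DERIV_isconst_all[of "\<lambda>x. F (x + 1) - F x" x 0] by simp
qed

text \<open>\<open>F\<close> rises strictly just to the right of \<open>x0\<close> and never falls
  on the rest of the period, so its increment over a period is positive.\<close>

lemma antiderivative_periodic_less:
  fixes F :: "real \<Rightarrow> real"
  assumes F: "\<And>x. (F has_field_derivative f x) (at x)" and f: "\<And>x. f (x + 1) = f x"
    and nonneg: "\<And>x. f x \<ge> 0" and pos: "f x0 > 0"
  shows "F 0 < F 1"
proof (rule ccontr)
  assume "\<not> F 0 < F 1"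
  then have le: "F (x0 + 1) \<le> F x0"
    using antiderivative_periodic_shift[OF F f, of x0] by simp
  obtain d where d: "d > 0" "\<And>h. 0 < h \<Longrightarrow> h < d \<Longrightarrow> F x0 < F (x0 + h)"
    using DERIV_pos_inc_right[OF F pos] by blast
  \<comment> \<open>Halving keeps \<open>h\<close> below \<open>d\<close>; the cap 1 keeps
    \<open>x0 + h\<close> within the period ending at \<open>x0 + 1\<close>.\<close>
  define h where "h = min (d / 2) 1"
  have "F x0 < F (x0 + h)"
    using d by (simp add: h_def min_less_iff_disj)
  also have "F (x0 + h) \<le> F (x0 + 1)"
    by (rule DERIV_nonneg_imp_nondecreasing) (use F nonneg in \<open>auto simp: h_def\<close>)
  finally show False
    using le by simp
qed

text \<open>Here \<open>b * \<phi>' = \<bar>b\<bar>^3 + \<beta> * b^3\<close>. Quadratic expressions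
  in \<open>b\<close> are chosen because \<open>\<phi>'\<close> has to be C1, whereas
  \<open>\<bar>b\<bar>\<close> may fail to be differentiable at zeros of \<open>b\<close>.\<close>

lemma exists_test_positive_drift:
  fixes b :: "circle \<Rightarrow> real"
  assumes b: "Ck_on 1 UNIV b" and "\<exists>p. b p > 0" "\<exists>p. b p < 0"
  obtains \<phi> \<gamma> where "Ck_on 2 UNIV \<phi>" "\<gamma> > 0" "\<And>p. \<gamma> * \<bar>b p\<bar> ^ 3 \<le> b p * circle_deriv \<phi> p"
proof -
  define B where "B t = b (circle_of t)" for t
  define B' where "B' t = circle_deriv b (circle_of t)" for t
  have B: "(B has_field_derivative B' t) (at t)" for t
    using C1_lift(1)[OF b] by (simp add: B_def[abs_def] B'_def)
  have contB: "continuous_on UNIV B"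
    using B by (meson DERIV_isCont continuous_at_imp_continuous_on)
  have contB': "continuous_on UNIV B'"
    using C1_lift(2)[OF b] continuous_on_circle_iff by (auto simp: B'_def[abs_def])
  have per: "B (t + 1) = B t" for t
    by (simp add: B_def)
  obtain s t where st: "B s > 0" "B t < 0"
    using assms(2,3) circle_of_surj by (metis B_def)
  obtain F where F: "\<And>x. (F has_field_derivative B x * \<bar>B x\<bar>) (at x)"
    by (rule antiderivative_exists[of "\<lambda>x. B x * \<bar>B x\<bar>"]) (intro continuous_intros contB, blast)
  obtain G where G: "\<And>x. (G has_field_derivative (B x)\<^sup>2) (at x)"
    by (rule antiderivative_exists[of "\<lambda>x. (B x)\<^sup>2"]) (intro continuous_intros contB, blast)
  \<comment> \<open>The integrand \<open>B\<^sup>2 + B * \<bar>B\<bar>\<close> is twice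
    \<open>B\<^sup>2\<close> where \<open>B > 0\<close> and zero elsewhere; the next inequality is
    its mirror image for \<open>B < 0\<close>. Together they give the strict bound behind
    \<open>\<bar>\<beta>\<bar> < 1\<close>.\<close>
  have "G 0 + F 0 < G 1 + F 1"
    by (rule antiderivative_periodic_less[OF DERIV_add[OF G F], where ?x0.0 = s])
      (use st in \<open>auto simp: per power2_eq_square abs_if\<close>)
  moreover have "G 0 - F 0 < G 1 - F 1"
    by (rule antiderivative_periodic_less[OF DERIV_diff[OF G F], where ?x0.0 = t])
      (use st in \<open>auto simp: per power2_eq_square abs_if mult_neg_neg\<close>)
  ultimately have lt: "\<bar>F 1 - F 0\<bar> < G 1 - G 0"
    by linarith
  define \<beta> where "\<beta> = - (F 1 - F 0) / (G 1 - G 0)"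
  have \<beta>: "\<bar>\<beta>\<bar> < 1" "F 1 - F 0 + \<beta> * (G 1 - G 0) = 0"
    using lt by (auto simp: \<beta>_def abs_divide divide_less_eq)
  define H where "H t = F t + \<beta> * G t" for t
  have H: "(H has_field_derivative B t * \<bar>B t\<bar> + \<beta> * (B t)\<^sup>2) (at t)" for t
    unfolding H_def by (auto intro!: derivative_eq_intros F G)
  have H': "((\<lambda>t. B t * \<bar>B t\<bar> + \<beta> * (B t)\<^sup>2) has_field_derivative
      2 * \<bar>B t\<bar> * B' t + 2 * \<beta> * B t * B' t) (at t)" for t
    by (rule DERIV_cong[OF DERIV_add[OF DERIV_chain2[OF DERIV_times_abs B[of t]]
          DERIV_cmult[OF DERIV_power[OF B[of t], where n = 2]]]]) simp
  \<comment> \<open>By the choice of \<open>\<beta>\<close> the derivative of \<open>H\<close> has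
    mean zero, so \<open>H\<close> descends to the circle.\<close>
  have "H (t + 1) = H t" for t
  proof -
    have "H 1 - H 0 = 0"
      using \<beta>(2) by (simp add: H_def algebra_simps)
    then show ?thesis
      using antiderivative_periodic_shift[OF H, of t] by (simp add: per)
  qed
  then obtain \<phi> where \<phi>: "\<And>t. \<phi> (circle_of t) = H t"
    using periodic_lift by blast
  have "continuous_on UNIV (\<lambda>t. 2 * \<bar>B t\<bar> * B' t + 2 * \<beta> * B t * B' t)"
    by (intro continuous_intros contB contB')
  note \<phi>_C2 = C2_circle[OF \<phi> H H' this]
  have "(1 - \<bar>\<beta>\<bar>) * \<bar>b p\<bar> ^ 3 \<le> b p * circle_deriv \<phi> p" for p
  proof -
    obtain t where t: "p = circle_of t"
      using circle_of_surj by blast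
    have "b p * circle_deriv \<phi> p = \<bar>B t\<bar> ^ 3 + \<beta> * B t ^ 3"
      unfolding t \<phi>_C2(2) B_def[symmetric]
      by (simp add: power3_eq_cube power2_eq_square algebra_simps)
    moreover have "\<beta> * B t ^ 3 \<ge> - (\<bar>\<beta>\<bar> * \<bar>B t\<bar> ^ 3)"
      by (metis abs_ge_minus_self abs_mult minus_le_iff power_abs)
    ultimately show ?thesis
      by (simp add: t B_def algebra_simps)
  qed
  then show thesis
    using that[OF \<phi>_C2(1), of "1 - \<bar>\<beta>\<bar>"] \<beta>(1) by simp
qed

section \<open>Measures carried by the zeros\<close>

text \<open>The function is a product of factors \<open>1 - cos (2 * pi * (t - z))\<close>, one for
  each point \<open>z\<close>. Knowing the zero set exactly makes the old product positive at a new
  point, which the second derivative there requires.\<close>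

lemma exists_nondegenerate_minima:
  assumes "finite Z"
  shows "\<exists>\<phi>. Ck_on 2 UNIV \<phi> \<and> (\<forall>p. \<phi> p \<ge> 0 \<and> (\<phi> p = 0 \<longleftrightarrow> p \<in> Z)) \<and>
    (\<forall>p\<in>Z. circle_deriv \<phi> p = 0 \<and> (circle_deriv ^^ 2) \<phi> p > 0)"
  using assms
proof induction
  case empty
  \<comment> \<open>The empty product.\<close>
  have "Ck_on 2 UNIV (\<lambda>_. 1)"
    by (rule C2_circle[where U = "\<lambda>_. 1" and U' = "\<lambda>_. 0" and U'' = "\<lambda>_. 0"]) auto
  then show ?case
    by (intro exI[of _ "\<lambda>_. 1"]) auto
next
  case (insert z Z)
  then obtain \<phi> where \<phi>: "Ck_on 2 UNIV \<phi>" "\<And>p. \<phi> p \<ge> 0" "\<And>p. \<phi> p = 0 \<longleftrightarrow> p \<in> Z"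
    "\<And>p. p \<in> Z \<Longrightarrow> circle_deriv \<phi> p = 0" "\<And>p. p \<in> Z \<Longrightarrow> (circle_deriv ^^ 2) \<phi> p > 0"
    by blast
  note \<phi>_lift = C2_lift[OF \<phi>(1)]
  have cont: "continuous_on UNIV (\<lambda>t. \<phi> (circle_of t))"
    "continuous_on UNIV (\<lambda>t. circle_deriv \<phi> (circle_of t))"
    "continuous_on UNIV (\<lambda>t. (circle_deriv ^^ 2) \<phi> (circle_of t))"
    unfolding continuous_on_circle_iff[symmetric]
    by (rule DERIV_lift_imp_continuous_on, rule \<phi>_lift | rule \<phi>_lift)+
  obtain z0 where z0: "z = circle_of z0"
    using circle_of_surj by blast
  \<comment> \<open>With this frequency \<open>q\<close> has period 1 and vanishes only on the class
    of \<open>z0\<close>.\<close>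
  define w :: real where "w = 2 * pi"
  define q where "q t = 1 - cos (w * (t - z0))" for t
  define q' where "q' t = w * sin (w * (t - z0))" for t
  define q'' where "q'' t = w\<^sup>2 * cos (w * (t - z0))" for t
  have q: "(q has_field_derivative q' t) (at t)" for t
    unfolding q_def q'_def by (auto intro!: derivative_eq_intros)
  have q': "(q' has_field_derivative q'' t) (at t)" for t
    unfolding q'_def q''_def by (auto intro!: derivative_eq_intros simp: power2_eq_square)
  have q'': "continuous_on UNIV q''"
    unfolding q''_def by (intro continuous_intros)
  have contq: "continuous_on UNIV q" "continuous_on UNIV q'"
    using q q' by (meson DERIV_isCont continuous_at_imp_continuous_on)+
  have q_nonneg: "q t \<ge> 0" for t
    by (simp add: q_def)
  have q_zero: "q t = 0 \<longleftrightarrow> circle_of t = z" for t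
  proof -
    have "q t = 0 \<longleftrightarrow> (\<exists>n::int. w * (t - z0) = of_int n * 2 * pi)"
      by (auto simp: q_def cos_one_2pi_int)
    also have "\<dots> \<longleftrightarrow> (\<exists>n::int. t - z0 = of_int n)"
      by (simp add: w_def)
    also have "\<dots> \<longleftrightarrow> circle_of t = z"
      by (auto simp: z0 circle_of_eq_iff Ints_def)
    finally show ?thesis .
  qed
  have q_at: "q' t = 0" "q'' t > 0" if "circle_of t = z" for t
  proof -
    have c: "cos (w * (t - z0)) = 1"
      using that q_zero[of t] by (simp add: q_def)
    then show "q' t = 0"
      using cos_one_sin_zero by (auto simp: q'_def)
    show "q'' t > 0"
      using c by (simp add: q''_def w_def)
  qed
  define U where "U t = \<phi> (circle_of t) * q t" for t
  have "q (t + 1) = q t" for t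
  proof -
    have "w * (t + 1 - z0) = w * (t - z0) + 2 * pi"
      by (simp add: w_def algebra_simps)
    then show ?thesis
      by (simp add: q_def)
  qed
  then obtain \<psi> where \<psi>: "\<And>t. \<psi> (circle_of t) = U t"
    using periodic_lift[of U] by (auto simp: U_def)
  define U' where "U' t = circle_deriv \<phi> (circle_of t) * q t + \<phi> (circle_of t) * q' t" for t
  define U'' where "U'' t = (circle_deriv ^^ 2) \<phi> (circle_of t) * q t
    + 2 * circle_deriv \<phi> (circle_of t) * q' t + \<phi> (circle_of t) * q'' t" for t
  have U: "(U has_field_derivative U' t) (at t)" for t
    unfolding U_def U'_def by (auto intro!: derivative_eq_intros \<phi>_lift q)
  have U': "(U' has_field_derivative U'' t) (at t)" for t
    unfolding U'_def U''_def by (auto intro!: derivative_eq_intros \<phi>_lift q q')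
  have "continuous_on UNIV U''"
    unfolding U''_def by (intro continuous_intros cont contq q'')
  note \<psi>_C2 = C2_circle[OF \<psi> U U' this]
  have "\<psi> p \<ge> 0 \<and> (\<psi> p = 0 \<longleftrightarrow> p \<in> insert z Z)" for p
    using circle_of_surj[of p] by (auto simp: \<psi> U_def \<phi>(2,3) q_nonneg q_zero)
  moreover have "circle_deriv \<psi> p = 0 \<and> (circle_deriv ^^ 2) \<psi> p > 0" if "p \<in> insert z Z" for p
  proof -
    obtain t where t: "p = circle_of t"
      using circle_of_surj by blast
    show ?thesis
    proof (cases "p = z")
      \<comment> \<open>At the new point \<open>q\<close> and \<open>q'\<close> vanish, so only
        \<open>\<phi> * q''\<close> survives in the second derivative.\<close>
      case True
      then have "q t = 0" "q' t = 0" "q'' t > 0"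
        using q_zero q_at t by auto
      moreover have "\<phi> p > 0"
        using \<phi>(2,3)[of p] True insert.hyps by (simp add: order_less_le)
      ultimately show ?thesis
        unfolding t \<psi>_C2 U'_def U''_def by (simp add: t)
    next
      \<comment> \<open>At an old point \<open>\<phi>\<close> and its derivative vanish, which
        leaves the second derivative of \<open>\<phi>\<close> times \<open>q\<close>.\<close>
      case False
      then have "p \<in> Z" "q t > 0"
        using that q_zero[of t] q_nonneg[of t] t by (auto simp: order_less_le)
      then show ?thesis
        using \<phi>(3-5)[of p] unfolding t \<psi>_C2 U'_def U''_def by simp
    qed
  qed
  ultimately show ?case
    using \<psi>_C2(1) by blast
qed

theorem proposition4p22:
  fixes a b :: "circle \<Rightarrow> real" and \<mu> :: "circle measure"
  assumes "Ck_on 2 UNIV a" and "\<And>p. a p > 0"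
    and "Ck_on 1 UNIV b"
    and "\<exists>p. b p > 0" and "\<exists>p. b p < 0"
    and "finite {p. b p = 0}"
    and "\<And>p. b p = 0 \<Longrightarrow> (\<exists>m\<ge>1. zero_of_order b p m) \<or> flat_zero b p"
    and "prob_space \<mu>" and "sets \<mu> = sets borel"
  shows "((\<lambda>\<epsilon>. rate_functional a b \<epsilon> \<mu>) \<longlongrightarrow> \<infinity>) (at_right 0)"
proof -
  interpret prob_space \<mu> by fact
  note \<mu> = assms(8,9)
  have a: "continuous_on UNIV a"
    by (rule DERIV_lift_imp_continuous_on, rule C2_lift(1)[OF assms(1)])
  have b: "continuous_on UNIV b"
    by (rule DERIV_lift_imp_continuous_on, rule C1_lift(1)[OF assms(3)])
  have C2_cont: "continuous_on UNIV (circle_deriv \<phi>)" "continuous_on UNIV ((circle_deriv ^^ 2) \<phi>)"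
    if "Ck_on 2 UNIV \<phi>" for \<phi>
    by (rule DERIV_lift_imp_continuous_on, rule C2_lift(2)[OF that]) (rule C2_lift(3)[OF that])
  note ge = rate_functional_ge[OF \<mu> a b]
  show ?thesis
  proof (cases "AE p in \<mu>. b p = 0")
    case False
    obtain \<phi> \<gamma> where \<phi>: "Ck_on 2 UNIV \<phi>" and \<gamma>: "\<gamma> > 0"
      and le: "\<And>p. \<gamma> * \<bar>b p\<bar> ^ 3 \<le> b p * circle_deriv \<phi> p"
      using exists_test_positive_drift[OF assms(3-5)] by blast
    define A where "A = (\<integral>p. a p * (circle_deriv ^^ 2) \<phi> p \<partial>\<mu>)"
    define Q where "Q = (\<integral>p. a p * (circle_deriv \<phi> p)\<^sup>2 \<partial>\<mu>)"
    define K where "K = (\<integral>p. b p * circle_deriv \<phi> p \<partial>\<mu>)"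
    have "integrable \<mu> (\<lambda>p. b p * circle_deriv \<phi> p)" "integrable \<mu> (\<lambda>p. \<gamma> * \<bar>b p\<bar> ^ 3)"
      by (intro integrable_circle[OF \<mu>] continuous_intros b C2_cont[OF \<phi>])+
    then have "(\<integral>p. \<gamma> * \<bar>b p\<bar> ^ 3 \<partial>\<mu>) \<le> K"
      unfolding K_def using le by (intro integral_mono) auto
    \<comment> \<open>A nonnegative integrand with integral zero vanishes almost everywhere,
      contrary to the case assumption on \<open>b\<close>.\<close>
    moreover have "(\<integral>p. \<gamma> * \<bar>b p\<bar> ^ 3 \<partial>\<mu>) \<noteq> 0"
      using False integral_nonneg_eq_0_iff_AE[OF \<open>integrable \<mu> (\<lambda>p. \<gamma> * \<bar>b p\<bar> ^ 3)\<close>] \<gamma> by auto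
    moreover have "(\<integral>p. \<gamma> * \<bar>b p\<bar> ^ 3 \<partial>\<mu>) \<ge> 0"
      using \<gamma> by (intro integral_nonneg_AE) auto
    ultimately have K: "K > 0"
      by linarith
    have Q: "Q \<ge> 0"
      unfolding Q_def using assms(2) by (intro integral_nonneg_AE) (auto simp: less_imp_le)
    \<comment> \<open>This choice gives \<open>K - s * Q = s\<close>, hence
      \<open>s * K - s\<^sup>2 * Q = s\<^sup>2\<close>; the added 1 covers
      \<open>Q = 0\<close>.\<close>
    define s where "s = K / (Q + 1)"
    have s: "s > 0" "s * K - s\<^sup>2 * Q > 0"
    proof -
      show "s > 0"
        using K Q by (simp add: s_def)
      have "K - s * Q = s"
        using Q by (simp add: s_def field_simps)
      then show "s * K - s\<^sup>2 * Q > 0"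
        using \<open>s > 0\<close> by (metis mult.assoc mult_pos_pos power2_eq_square right_diff_distrib)
    qed
    \<comment> \<open>With \<open>c\<close> of order \<open>1 / \<epsilon>\<close> the drift and
      quadratic terms both scale like \<open>1 / \<epsilon>\<close>, while the \<open>A\<close> term
      stays constant.\<close>
    have "ereal (s * A + (s * K - s\<^sup>2 * Q) / \<epsilon>) \<le> rate_functional a b \<epsilon> \<mu>" if "\<epsilon> > 0" for \<epsilon>
    proof -
      have "- \<epsilon> * (- s / \<epsilon>) * A - \<epsilon> * (- s / \<epsilon>)\<^sup>2 * Q - (- s / \<epsilon>) * K
          = s * A + (s * K - s\<^sup>2 * Q) / \<epsilon>"
        using that by (simp add: field_simps power2_eq_square)
      then show ?thesis
        using ge[OF \<phi>, of \<epsilon> "- s / \<epsilon>"] unfolding A_def Q_def K_def by simp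
    qed
    then show ?thesis
      by (rule tendsto_PInfty_at_right_0[OF s(2)])
  next
    case True
    obtain \<phi> where \<phi>: "Ck_on 2 UNIV \<phi>"
      and crit: "\<And>p. b p = 0 \<Longrightarrow> circle_deriv \<phi> p = 0"
      and pos: "\<And>p. b p = 0 \<Longrightarrow> (circle_deriv ^^ 2) \<phi> p > 0"
      using exists_nondegenerate_minima[OF assms(6)] by blast
    define A where "A = (\<integral>p. a p * (circle_deriv ^^ 2) \<phi> p \<partial>\<mu>)"
    have "(\<integral>p. 0 \<partial>\<mu>) < A"
      unfolding A_def
    proof (rule integral_less_AE_space)
      show "integrable \<mu> (\<lambda>p. a p * (circle_deriv ^^ 2) \<phi> p)"
        by (intro integrable_circle[OF \<mu>] continuous_intros a C2_cont[OF \<phi>])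
      show "AE p in \<mu>. 0 < a p * (circle_deriv ^^ 2) \<phi> p"
        using True by eventually_elim (simp add: assms(2) pos)
    qed (simp_all add: emeasure_space_1)
    then have A: "A > 0"
      by simp
    have Q: "(\<integral>p. a p * (circle_deriv \<phi> p)\<^sup>2 \<partial>\<mu>) = 0"
      by (rule integral_eq_zero_AE) (use True in eventually_elim, simp add: crit)
    have K: "(\<integral>p. b p * circle_deriv \<phi> p \<partial>\<mu>) = 0"
      by (rule integral_eq_zero_AE) (use True in eventually_elim, simp)
    \<comment> \<open>With \<open>Q = K = 0\<close> the bound is
      \<open>- \<epsilon> * c * A\<close>, linear in \<open>c\<close>. It diverges once
      \<open>\<bar>c\<bar>\<close> outgrows \<open>1 / \<epsilon>\<close>, as
      \<open>1 / \<epsilon>\<^sup>2\<close> does.\<close>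
    have "ereal (0 + A / \<epsilon>) \<le> rate_functional a b \<epsilon> \<mu>" if "\<epsilon> > 0" for \<epsilon>
    proof -
      have "- \<epsilon> * (- 1 / \<epsilon>\<^sup>2) * A = A / \<epsilon>"
        using that by (simp add: power2_eq_square)
      then show ?thesis
        using ge[OF \<phi>, of \<epsilon> "- 1 / \<epsilon>\<^sup>2"] unfolding A_def Q K by simp
    qed
    then show ?thesis
      by (rule tendsto_PInfty_at_right_0[OF A])
  qed
qed

end
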